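(* For integers $s\ge 1$ and $r$, let $P_{s,r}(q,N)=\sum_{\pi}q^{|\pi|}$ be the generating function of the integer partitions $\pi$ (written with parts in non-decreasing order, the empty partition included, $|\pi|$ the sum of the parts) such that: (a) every part of $\pi$ is at most $N$; (b) every part is at least $s$; (c) parts that are two positions apart differ by at least $3$; (d) if two consecutive parts differ by at most $1$, then their sum is congruent to $r$ modulo $3$. Let $$S(0,-1;q,N):=P_{1,2}(q,N),\quad S(0,0;q,N):=P_{1,0}(q,N),\quad S(1,1;q,N):=P_{2,1}(q,N),\quad S(1,2;q,N):=P_{2,2}(q,N),$$ $$S(2,3;q,N):=P_{3,0}(q,N),\quad S(2,4;q,N):=P_{3,1}(q,N),\quad S(3,5;q,N):=P_{4,2}(q,N),\quad S(3,6;q,N):=P_{4,0}(q,N).$$ Then, for every non-negative integer $N$, $$S(0,-1;q,N)=\sum_{m,n\ge 0}q^{m^2+3mn+3n^2-n}\begin{bmatrix}N+1-3n-m\\ m\end{bmatrix}_q\begin{bmatrix}\lfloor\frac23(N+2)\rfloor-m-n\\ n\end{bmatrix}_{q^3},$$ $$S(0,0;q,N)=\sum_{m,n\ge 0}q^{m^2+3mn+3n^2}\begin{bmatrix}N+1-3n-m\\ m\end{bmatrix}_q\begin{bmatrix}\lfloor\frac23N\rfloor+1-m-n\\ n\end{bmatrix}_{q^3},$$ $$S(1,1;q,N)=\sum_{m,n\ge 0}q^{m^2+3mn+3n^2+m+n}\begin{bmatrix}N-3n-m\\ m\end{bmatrix}_q\begin{bmatrix}\lfloor\frac23(N+1)\rfloor-m-n\\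 n\end{bmatrix}_{q^3},$$ $$S(1,2;q,N)=\sum_{m,n\ge 0}q^{m^2+3mn+3n^2+m+2n}\begin{bmatrix}N-3n-m\\ m\end{bmatrix}_q\begin{bmatrix}\lfloor\frac23(N-1)\rfloor+1-m-n\\ n\end{bmatrix}_{q^3},$$ $$S(2,3;q,N)=\sum_{m,n\ge 0}q^{m^2+3mn+3n^2+2m+3n}\begin{bmatrix}N-3n-m-1\\ m\end{bmatrix}_q^{\star}\begin{bmatrix}\lfloor\frac23N\rfloor-m-n\\ n\end{bmatrix}_{q^3},$$ $$S(2,4;q,N)=\sum_{m,n\ge 0}q^{m^2+3mn+3n^2+2m+4n}\begin{bmatrix}N-3n-m-1\\ m\end{bmatrix}_q\begin{bmatrix}\lfloor\frac23(N-1)\rfloor+\delta_{3\mid (N-2)}-m-n\\ n\end{bmatrix}_{q^3},$$ $$S(3,5;q,N)=\sum_{m,n\ge 0}q^{m^2+3mn+3n^2+3m+5n}\begin{bmatrix}N-3n-m-2\\ m\end{bmatrix}_q\begin{bmatrix}\lfloor\frac23(N-1)\rfloor-m-n\\ n\end{bmatrix}_{q^3},$$ $$S(3,6;q,N)=\sum_{m,n\ge 0}q^{m^2+3mn+3n^2+3m+6n}\begin{bmatrix}N-3n-m-2\\ m\end{bmatrix}_q\begin{bmatrix}\lfloor\frac23N\rfloor-1-m-n\\ n\end{bmatrix}_{q^3}.$$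
   Context: Notation: $(x;q)_n=\prod_{i=0}^{n-1}(1-q^ix)$. For $k,l\in\mathbb{Z}$ the Gaussian binomial coefficient is $\begin{bmatrix}k\\ l\end{bmatrix}_q=\frac{(q;q)_k}{(q;q)_l(q;q)_{k-l}}$ if $k\ge l\ge 0$, and $0$ if $l<0$ or $k<l$; the subscript $q^3$ means that $q$ is replaced by $q^3$. The starred coefficient, which occurs only in the formula for $S(2,3;q,N)$, equals the ordinary one except that it is understood to be $1$ when it becomes $\begin{bmatrix}-1\\ 0\end{bmatrix}_q$ (which only happens when $N\equiv 0 \pmod 3$). $\delta_{3\mid (N-2)}$ is $1$ if $3$ divides $N-2$ and $0$ otherwise. $\lfloor x\rfloor$ is the greatest integer less than or equal to $x$. These polynomials in $q$ are finite versions of the series $S(a,b;q)=\sum_{m,n\ge 0}\frac{q^{m^2+3mn+3n^2+am+bn}}{(q;q)_m(q^3;q^3)_n}$. The formulas for $S(0,0;q,N)$, $S(1,2;q,N)$ and $S(2,3;q,N)$ were already found by Uncu and Zudilin.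
   Formalization: As printed, some formulas fail (e.g. S(0,-1), N=1: 1+q+q^2 versus 1+q). Proved instead: the first coefficient is starred also in S(0,-1), S(1,1), S(3,5), and the value is 1 for S(2,4), S(3,5) at N=0 and S(3,6) at N=0,1, where the printed sum is 0. *)

theory Defs
  imports
    "HOL-Computational_Algebra.Polynomial"
    "HOL-Number_Theory.Cong"
    "HOL-Library.Groups_Big_Fun"
begin

text \<open>All identities are identities of polynomials in the indeterminate \<open>q\<close> over the integers.\<close>

abbreviation q :: "int poly" where
  "q \<equiv> [:0, 1:]"


section \<open>Gaussian binomial coefficients\<close>

definition qpoch :: "'a::comm_ring_1 \<Rightarrow> 'a \<Rightarrow> nat \<Rightarrow> 'a" where
  "qpoch x p n = (\<Prod>i<n. 1 - p ^ i * x)"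

text \<open>The base \<open>p\<close> is \<open>q\<close> or \<open>q ^ 3\<close>. The division is division of integer polynomials; it is
  exact, see \<open>gauss_mult\<close> below.\<close>

definition gauss :: "int poly \<Rightarrow> int \<Rightarrow> int \<Rightarrow> int poly" where
  "gauss p k l =
     (if 0 \<le> l \<and> l \<le> k
      then qpoch p p (nat k) div (qpoch p p (nat l) * qpoch p p (nat (k - l)))
      else 0)"

text \<open>The ordinary coefficient vanishes for \<open>k = -1\<close>, \<open>l = 0\<close>; the starred one is 1 there. In the
  finite sums for \<open>S(0,-1)\<close>, \<open>S(1,1)\<close>, \<open>S(2,3)\<close>, \<open>S(3,5)\<close> the starred coefficient differs from the
  ordinary one only if \<open>N\<close> is congruent modulo 3 to 1, 2, 0, 1 respectively, and in a single term;
  with the ordinary coefficient these four identities fail for every such \<open>N\<close>. For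
  instance, for \<open>S(0,-1)\<close> and \<open>N = 1\<close> the partition \<open>1 + 1\<close> would be missed.\<close>

definition gauss_star :: "int poly \<Rightarrow> int \<Rightarrow> int \<Rightarrow> int poly" where
  "gauss_star p k l = (if k = -1 \<and> l = 0 then 1 else gauss p k l)"

lemma qpoch_same_Suc: "qpoch p p (Suc n) = qpoch p p n * (1 - p ^ Suc n)"
  by (simp add: qpoch_def mult.commute)

lemma qpoch_dvd: "qpoch p p l * qpoch p p j dvd qpoch p p (l + j)"
proof (induction "l + j" arbitrary: l j)
  case 0
  then show ?case by (simp add: qpoch_def)
next
  case (Suc n)
  show ?case
  proof (cases "l = 0 \<or> j = 0")
    case True
    then show ?thesis by (auto simp: qpoch_def)
  next
    case False
    then obtain a b where ab: "l = Suc a" "j = Suc b"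
      by (metis not0_implies_Suc)
    have n: "n = a + Suc b" "n = Suc a + b"
      using Suc.hyps(2) ab by auto
    have "qpoch p p a * qpoch p p (Suc b) dvd qpoch p p n"
      using Suc.hyps(1)[OF n(1)] n(1) by simp
    then have 1: "qpoch p p l * qpoch p p j dvd qpoch p p n * (1 - p ^ l)"
      unfolding ab qpoch_same_Suc[of p a]
      by (metis (no_types, lifting) mult.assoc mult.commute mult_dvd_mono dvd_refl)
    have "qpoch p p (Suc a) * qpoch p p b dvd qpoch p p n"
      using Suc.hyps(1)[OF n(2)] n(2) by simp
    then have 2: "qpoch p p l * qpoch p p j dvd qpoch p p n * (1 - p ^ j)"
      unfolding ab qpoch_same_Suc[of p b]
      by (metis (no_types, lifting) mult.assoc mult_dvd_mono dvd_refl)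
    have "l + j = Suc n" using Suc.hyps(2) by simp
    then have "qpoch p p (l + j) = qpoch p p n * (1 - p ^ (l + j))"
      by (simp only: qpoch_same_Suc)
    also have "\<dots> = qpoch p p n * (1 - p ^ l) + p ^ l * (qpoch p p n * (1 - p ^ j))"
      by (simp add: power_add algebra_simps)
    finally show ?thesis
      using 1 2 by (metis dvd_add dvd_mult)
  qed
qed

lemma gauss_mult:
  assumes "0 \<le> l" "l \<le> k"
  shows "gauss p k l * (qpoch p p (nat l) * qpoch p p (nat (k - l))) = qpoch p p (nat k)"
proof -
  have "nat k = nat l + nat (k - l)"
    using assms by simp
  then have "qpoch p p (nat l) * qpoch p p (nat (k - l)) dvd qpoch p p (nat k)"
    using qpoch_dvd[of p "nat l" "nat (k - l)"] by simp
  then show ?thesis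
    using assms by (simp add: gauss_def)
qed

text \<open>The sums over all \<open>m, n \<ge> 0\<close> are rendered by \<^const>\<open>Sum_any\<close>, which sums over the support;
  the support is finite.\<close>

lemma finite_support_gauss_star:
  "finite {(m::nat, n::nat). c m n * gauss_star p (A - 3 * int n - int m) (int m) * d m n \<noteq> 0}"
proof (rule finite_subset)
  show "{(m::nat, n::nat). c m n * gauss_star p (A - 3 * int n - int m) (int m) * d m n \<noteq> 0}
          \<subseteq> {..nat (A + 1)} \<times> {..nat (A + 1)}"
    by (auto simp: gauss_star_def gauss_def split: if_splits)
qed auto

lemma finite_support_gauss:
  "finite {(m::nat, n::nat). c m n * gauss p (A - 3 * int n - int m) (int m) * d m n \<noteq> 0}"
proof (rule finite_subset)
  show "{(m::nat, n::nat). c m n * gauss p (A - 3 * int n - int m) (int m) * d m n \<noteq> 0}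
          \<subseteq> {..nat A} \<times> {..nat A}"
    by (auto simp: gauss_def split: if_splits)
qed auto


section \<open>The partitions and their generating functions\<close>

text \<open>Partitions are lists of parts in non-decreasing order. All parts are positive because the
  lower bound \<open>s\<close> is at least 1 in every use.\<close>

definition partitions :: "nat \<Rightarrow> int \<Rightarrow> nat \<Rightarrow> nat list set" where
  "partitions s r N =
     {\<pi>. sorted \<pi>
        \<and> (\<forall>x\<in>set \<pi>. x \<le> N)
        \<and> (\<forall>x\<in>set \<pi>. s \<le> x)
        \<and> (\<forall>i. i + 2 < length \<pi> \<longrightarrow> \<pi> ! i + 3 \<le> \<pi> ! (i + 2))
        \<and> (\<forall>i. i + 1 < length \<pi> \<and> \<pi> ! (i + 1) \<le> \<pi> ! i + 1
              \<longrightarrow> [int (\<pi> ! i) + int (\<pi> ! (i + 1)) = r] (mod 3))}"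

definition P :: "nat \<Rightarrow> int \<Rightarrow> nat \<Rightarrow> int poly" where
  "P s r N = (\<Sum>\<pi>\<in>partitions s r N. q ^ sum_list \<pi>)"

lemma finite_partitions: "finite (partitions s r N)"
proof (rule finite_subset)
  show "partitions s r N \<subseteq> {\<pi>. set \<pi> \<subseteq> {..N} \<and> length \<pi> \<le> 2 * N + 2}"
  proof
    fix \<pi> assume \<pi>: "\<pi> \<in> partitions s r N"
    then have "set \<pi> \<subseteq> {..N}" by (auto simp: partitions_def)
    have gap: "\<pi> ! i + 3 \<le> \<pi> ! (i + 2)" if "i + 2 < length \<pi>" for i
      using \<pi> that by (simp add: partitions_def)
    have ge: "2 * i < length \<pi> \<Longrightarrow> 3 * i \<le> \<pi> ! (2 * i)" for i
    proof (induction i)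
      case (Suc i)
      then show ?case using gap[of "2 * i"] by simp
    qed simp
    have "length \<pi> \<le> 2 * N + 2"
    proof (rule ccontr)
      assume "\<not> length \<pi> \<le> 2 * N + 2"
      then have len: "2 * (N + 1) < length \<pi>" by simp
      then have "\<pi> ! (2 * (N + 1)) \<le> N"
        using \<pi> nth_mem[OF len] unfolding partitions_def by blast
      with ge[OF len] show False by simp
    qed
    with \<open>set \<pi> \<subseteq> {..N}\<close> show "\<pi> \<in> {\<pi>. set \<pi> \<subseteq> {..N} \<and> length \<pi> \<le> 2 * N + 2}"
      by simp
  qed
  show "finite {\<pi>. set \<pi> \<subseteq> {..N} \<and> length \<pi> \<le> 2 * N + 2}"
    by (rule finite_lists_length_le) simp
qed

text \<open>In the following names \<open>m1\<close> stands for the index \<open>-1\<close>. If \<open>N < s\<close>, only the empty partition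
  remains and \<open>P s r N = 1\<close>. With Gaussian coefficients that vanish for negative upper index, the
  double sums for \<open>S(2,4)\<close> (\<open>N = 0\<close>), \<open>S(3,5)\<close> (\<open>N = 0\<close>) and \<open>S(3,6)\<close> (\<open>N = 0, 1\<close>) are 0; for these
  values of \<open>N\<close> the theorem gives the value 1 directly.\<close>

abbreviation "S_0_m1 \<equiv> P 1 2"
abbreviation "S_0_0 \<equiv> P 1 0"
abbreviation "S_1_1 \<equiv> P 2 1"
abbreviation "S_1_2 \<equiv> P 2 2"
abbreviation "S_2_3 \<equiv> P 3 0"
abbreviation "S_2_4 \<equiv> P 3 1"
abbreviation "S_3_5 \<equiv> P 4 2"
abbreviation "S_3_6 \<equiv> P 4 0"

end

theory Submission
  imports Defs
begin

text \<open>The idea is that the generating functions and the double sums satisfy the same recurrences in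
  \<open>N\<close>, and that the steps of these recurrences on the side of the double sums are single applications
  of Pascal's rule.

  Let \<open>F N\<close> be the generating function of the partitions with parts between \<open>s\<close> and \<open>N\<close>. Removing
  the greatest part, or the two greatest parts if they differ by at most 1, gives
  for \<open>N \<ge> s\<close> the following relations (\<open>P_recurrence_double\<close>, \<open>P_recurrence_simple\<close>,
  \<open>P_recurrence_adjacent\<close>). If \<open>2 N\<close> is congruent to \<open>r\<close> modulo 3, so that \<open>N, N\<close> is an
  admissible pair, then \<open>F N = F (N-1) + q^N F (N-2) + q^(2N) F (N-3)\<close>. If neither \<open>N, N\<close>
  nor \<open>N-1, N\<close> is admissible, then \<open>F N = F (N-1) + q^N F (N-2)\<close>. If \<open>N-1, N\<close> is admissible
  and \<open>N > s\<close>, then \<open>F N = F (N-1) + q^N F' (N-2) + q^(2N-1) F (N-3)\<close>, where \<open>F'\<close> counts the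
  partitions in which the greatest admissible part size occurs at most once; for \<open>N \<ge> s + 2\<close> it is
  \<open>F' (N-2) = F (N-3) + q^(N-2) F (N-4)\<close>.

  For the double sums put \<open>j = s - 1\<close>, and let \<open>c = 1\<close> for the sums with starred coefficients and
  \<open>c = 0\<close> for the others. If the numbers \<open>A\<close> and \<open>B\<close> in the upper entries \<open>A - 3n - m\<close> and \<open>B - m - n\<close> are
  independent parameters, Pascal's rule for the first and the second coefficient gives
  \<open>G(A, B) = G(A-1, B) + q^(A+j-1) G(A-2, B-1)\<close> (\<open>double_sum_recurrence_m\<close>) and
  \<open>G(A, B) = G(A, B-1) + q^(3B+2j-c-3) G(A-3, B-2)\<close> (\<open>double_sum_recurrence_n\<close>), where \<open>G\<close> is
  \<open>double_sum c j\<close>. With \<open>M = N - j\<close>, every one of the eight sums is \<open>G(M+1, \<lfloor>(2M+c)/3\<rfloor>+1)\<close>. Put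
  \<open>M = 3k + c + i\<close> with \<open>i = 0, 1, 2\<close>; these three cases are the three cases above.
  In the second case the first rule for \<open>G\<close> is the recurrence for \<open>F\<close>. In
  the other two, the second rule splits off the partitions that end with a close pair, and the first
  rule treats the rest; in the third case, \<open>F' (N-2)\<close> is \<open>G(A-2, B-2)\<close>.

  Coefficients with negative upper entry make Pascal's rule fail in single terms.
  The starred coefficient is used throughout: with it, the failures only meet vanishing terms in
  the range that is needed, and for \<open>c = 0\<close> it may be replaced by the ordinary one
  (\<open>unstarred_eq_summand\<close>).\<close>

section \<open>Pascal rules for Gaussian coefficients\<close>

lemma gauss_neg: "k < l \<Longrightarrow> gauss p k l = 0"
  by (simp add: gauss_def)

lemma qpoch_nonzero:
  fixes p :: "int poly"
  assumes "degree p > 0"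
  shows "qpoch p p n \<noteq> 0"
proof -
  have "1 - p ^ i * p \<noteq> 0" for i
  proof
    assume "1 - p ^ i * p = 0"
    then have "p ^ Suc i = 1" by (simp add: mult.commute)
    then have "degree (p ^ Suc i) = 0" by simp
    moreover have "p \<noteq> 0" using assms by auto
    ultimately show False using assms by (metis degree_power_eq mult_eq_0_iff nat.distinct(1) neq0_conv)
  qed
  then show ?thesis by (simp add: qpoch_def)
qed

lemma gauss_0_right:
  assumes "degree p > 0" "0 \<le> k"
  shows "gauss p k 0 = 1"
  using assms qpoch_nonzero[of p] by (simp add: gauss_def qpoch_def[of _ _ 0])

lemma gauss_self:
  assumes "degree p > 0" "0 \<le> k"
  shows "gauss p k k = 1"
  using assms qpoch_nonzero[of p] by (simp add: gauss_def qpoch_def[of _ _ 0])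

lemma gauss_pascal:
  assumes p: "degree p > 0" and k: "1 \<le> k" and l: "0 \<le> l"
  shows "gauss p k l = gauss p (k - 1) l + p ^ nat (k - l) * gauss p (k - 1) (l - 1)"
proof -
  consider "l = 0" | "l = k" | "k < l" | "1 \<le> l" "l < k" using l by linarith
  then show ?thesis
  proof cases
    case 1
    then show ?thesis using k gauss_0_right[OF p, of k] gauss_0_right[OF p, of "k-1"]
      by (simp add: gauss_def[of _ _ "-1"])
  next
    case 2
    then show ?thesis using k gauss_self[OF p, of k] gauss_self[OF p, of "k-1"]
      by (simp add: gauss_neg)
  next
    case 3
    then show ?thesis by (simp add: gauss_neg)
  next
    case 4
    define Q where "Q = qpoch p p"
    have Suc: "Q (Suc n) = Q n * (1 - p ^ Suc n)" for n
      by (simp only: Q_def qpoch_same_Suc)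
    obtain a where a: "l = int (Suc a)" using 4 by (metis not0_implies_Suc nonneg_int_cases l of_nat_0 not_one_le_zero)
    obtain b where "k - l = int b" using 4 by (metis nonneg_int_cases diff_ge_0_iff_ge less_imp_le)
    with 4 obtain b' where b: "k - l = int (Suc b')" by (cases b) auto
    have ka: "k = int (Suc (Suc (a + b')))" using a b by simp
    have nats: "nat l = Suc a" "nat (l - 1) = a" "nat k = Suc (Suc (a + b'))"
      "nat (k - 1) = Suc (a + b')" "nat (k - l) = Suc b'" "nat (k - 1 - l) = b'"
      "nat (k - 1 - (l - 1)) = Suc b'"
      unfolding ka a by simp_all
    have *: "gauss p k l * (Q (Suc a) * Q (Suc b')) = Q (Suc (Suc (a + b')))"
      using gauss_mult[of l k p] 4 unfolding nats Q_def by simp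
    have **: "gauss p (k - 1) l * (Q (Suc a) * Q b') = Q (Suc (a + b'))"
      using gauss_mult[of l "k - 1" p] 4 unfolding nats Q_def by simp
    have ***: "gauss p (k - 1) (l - 1) * (Q a * Q (Suc b')) = Q (Suc (a + b'))"
      using gauss_mult[of "l - 1" "k - 1" p] 4 unfolding nats Q_def by simp
    have e: "nat (k - l) = Suc b'" using b by simp
    have "(gauss p (k - 1) l + p ^ nat (k - l) * gauss p (k - 1) (l - 1)) * (Q (Suc a) * Q (Suc b'))
      = (gauss p (k - 1) l * (Q (Suc a) * Q b')) * (1 - p ^ Suc b')
        + p ^ Suc b' * ((gauss p (k - 1) (l - 1) * (Q a * Q (Suc b'))) * (1 - p ^ Suc a))"
      unfolding e Suc by (simp only: algebra_simps)
    also have "\<dots> = Q (Suc (a + b')) * (1 - p ^ Suc (Suc (a + b')))"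
      unfolding ** *** by (simp add: algebra_simps power_add)
    also have "\<dots> = gauss p k l * (Q (Suc a) * Q (Suc b'))"
      unfolding * by (simp only: Suc)
    finally show ?thesis
      using qpoch_nonzero[OF p] by (simp add: Q_def)
  qed
qed

text \<open>With the convention that the coefficient is 1 at \<open>(-1, 0)\<close>, Pascal's rule fails only at the two
  places excluded here: at \<open>(-1, 0)\<close> itself, and at \<open>(0, 1)\<close>, where \<open>(-1, 0)\<close> occurs on the right.\<close>

lemma gauss_star_pascal:
  assumes "0 \<le> l" "(k, l) \<noteq> (-1, 0)" "(k, l) \<noteq> (0, 1)"
  shows "gauss_star q k l
    = gauss_star q (k - 1) l + q ^ nat (k - l) * gauss_star q (k - 1) (l - 1)"
proof (cases "1 \<le> k")
  case True
  then show ?thesis using gauss_pascal[of q k l] assms by (simp add: gauss_star_def)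
next
  case False
  then show ?thesis using assms
    by (cases "k = 0 \<and> l = 0") (auto simp: gauss_star_def gauss_def qpoch_def)
qed

section \<open>The double sums and their recurrences\<close>

text \<open>All eight double sums are instances of one family. The number \<open>j\<close> is \<open>s - 1\<close>; the linear
  part of the exponent is \<open>j (m + 2n) - c n\<close>, where \<open>c = 1\<close> gives the sums \<open>S(0,-1)\<close>, \<open>S(1,1)\<close>,
  \<open>S(2,3)\<close>, \<open>S(3,5)\<close> and \<open>c = 0\<close> gives \<open>S(0,0)\<close>, \<open>S(1,2)\<close>, \<open>S(2,4)\<close>, \<open>S(3,6)\<close>. The upper
  entries \<open>A\<close> and \<open>B\<close> vary independently. The subtraction of natural numbers in the exponent is
  exact for \<open>c \<le> 1\<close>, see \<open>int_exponent\<close>.\<close>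

definition summand :: "nat \<Rightarrow> nat \<Rightarrow> int \<Rightarrow> int \<Rightarrow> nat \<Rightarrow> nat \<Rightarrow> int poly" where
  "summand c j A B m n = q ^ (m^2 + 3*m*n + 3*n^2 + j*(m + 2*n) - c*n)
     * gauss_star q (A - 3 * int n - int m) (int m) * gauss (q^3) (B - int m - int n) (int n)"

definition double_sum :: "nat \<Rightarrow> nat \<Rightarrow> int \<Rightarrow> int \<Rightarrow> int poly" where
  "double_sum c j A B = Sum_any (\<lambda>(m, n). summand c j A B m n)"

lemma summand_eq_0:
  assumes "A + 1 < int m \<or> A + 1 < int n"
  shows "summand c j A B m n = 0"
  using assms by (auto simp: summand_def gauss_star_def gauss_def)

text \<open>The sum may be taken over any sufficiently large box, which allows index shifts.\<close>

lemma double_sum_box: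
  assumes "A + 1 < int K" "A + 1 < int L"
  shows "double_sum c j A B = (\<Sum>m<K. \<Sum>n<L. summand c j A B m n)"
proof -
  have "double_sum c j A B = (\<Sum>(m, n)\<in>{..<K} \<times> {..<L}. summand c j A B m n)"
    unfolding double_sum_def
  proof (rule Sum_any.expand_superset)
    show "{a. (case a of (m, n) \<Rightarrow> summand c j A B m n) \<noteq> 0} \<subseteq> {..<K} \<times> {..<L}"
    proof (rule subsetI, clarsimp simp del: lessThan_iff)
      fix m n assume "summand c j A B m n \<noteq> 0"
      then have "\<not> (A + 1 < int m \<or> A + 1 < int n)" using summand_eq_0 by blast
      with assms show "m \<in> {..<K} \<and> n \<in> {..<L}" by auto
    qed
  qed simp
  then show ?thesis by (simp add: sum.cartesian_product)
qed

lemma degree_q3: "degree (q ^ 3) > 0"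
  by (simp add: degree_power_eq)

lemma int_exponent:
  assumes "c \<le> (1::nat)"
  shows "int (m^2 + 3*m*n + 3*n^2 + j*(m + 2*n) - c*n)
    = int m^2 + 3*int m*int n + 3*int n^2 + int j*(int m + 2*int n) - int c*int n"
proof -
  have "c * n \<le> n\<^sup>2" using assms by (cases n) (auto simp: power2_eq_square le_Suc_eq)
  then have "c * n \<le> m^2 + 3*m*n + 3*n^2 + j*(m + 2*n)" by linarith
  then show ?thesis by (simp add: of_nat_diff)
qed

text \<open>This and \<open>summand_0_m\<close> are Pascal's rule for the first coefficient. The hypothesis \<open>3 B \<le> 2 A\<close>
  makes the second coefficient vanish where the rule fails, which is \<open>(0, 1)\<close> here and \<open>(-1, 0)\<close> in
  \<open>summand_0_m\<close>.\<close>

lemma summand_Suc_m: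
  assumes c: "c \<le> 1" and "1 \<le> A" "3 * B \<le> 2 * A"
  shows "summand c j A B (Suc m) n = summand c j (A - 1) B (Suc m) n
    + q ^ nat (A + int j - 1) * summand c j (A - 2) (B - 1) m n"
proof -
  define k where "k = A - 3 * int n - int (Suc m)"
  define l where "l = int (Suc m)"
  define h where "h = gauss (q^3) (B - 1 - int m - int n) (int n)"
  define e where "e = m^2 + 3*m*n + 3*n^2 + j*(m + 2*n) - c*n"
  define e' where "e' = (Suc m)^2 + 3*(Suc m)*n + 3*n^2 + j*(Suc m + 2*n) - c*n"
  have s1: "summand c j A B (Suc m) n = q^e' * gauss_star q k l * h"
    by (simp add: summand_def k_def l_def h_def e'_def algebra_simps)
  have s2: "summand c j (A - 1) B (Suc m) n = q^e' * gauss_star q (k - 1) l * h"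
    by (simp add: summand_def k_def l_def h_def e'_def algebra_simps)
  have s3: "summand c j (A - 2) (B - 1) m n = q^e * gauss_star q (k - 1) (l - 1) * h"
    by (simp add: summand_def k_def l_def h_def e_def algebra_simps)
  show ?thesis
  proof (cases "h = 0 \<or> (k - 1 < l - 1)")
    case True
    show ?thesis
    proof (cases "h = 0")
      case True then show ?thesis by (simp add: s1 s2 s3)
    next
      case False
      have "\<not> (k = 0 \<and> l = 1)"
      proof
        assume *: "k = 0 \<and> l = 1"
        then have "m = 0" "A = 3 * int n + 1" by (auto simp: k_def l_def)
        with assms(3) have "B \<le> 2 * int n" by presburger
        with \<open>m = 0\<close> have "h = 0" by (simp add: h_def gauss_def)
        with False show False by simp
      qed
      moreover have "k < l" using True False by simp
      ultimately have "gauss_star q k l = 0" "gauss_star q (k - 1) l = 0"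
        "gauss_star q (k - 1) (l - 1) = 0"
        by (auto simp: gauss_star_def gauss_def l_def)
      then show ?thesis by (simp add: s1 s2 s3)
    qed
  next
    case False
    have "gauss_star q k l
      = gauss_star q (k - 1) l + q ^ nat (k - l) * gauss_star q (k - 1) (l - 1)"
      using False by (intro gauss_star_pascal) (auto simp: l_def)
    moreover have "e' + nat (k - l) = nat (A + int j - 1) + e"
    proof -
      have "int (nat (k - l)) = A - 3 * int n - 2 * (int m + 1)" using False by (simp add: k_def l_def)
      moreover have "int (nat (A + int j - 1)) = A + int j - 1" using assms by simp
      ultimately have "int (e' + nat (k - l)) = int (nat (A + int j - 1) + e)"
        unfolding of_nat_add e'_def e_def int_exponent[OF c]
        by (simp add: algebra_simps power2_eq_square)
      then show ?thesis by (simp only: of_nat_eq_iff)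
    qed
    then have "q ^ e' * q ^ nat (k - l) = q ^ nat (A + int j - 1) * q ^ e"
      by (simp only: power_add[symmetric])
    ultimately show ?thesis unfolding s1 s2 s3
      by (metis (no_types, lifting) distrib_left distrib_right mult.assoc)
  qed
qed

lemma summand_0_m:
  assumes "1 \<le> A" "3 * B \<le> 2 * A"
  shows "summand c j A B 0 n = summand c j (A - 1) B 0 n"
proof (cases "A - 3 * int n = -1")
  case True
  with assms(2) have "B < 2 * int n" by presburger
  then show ?thesis by (simp add: summand_def gauss_def)
next
  case False
  then show ?thesis
    using gauss_star_pascal[of 0 "A - 3 * int n"]
    by (simp add: summand_def gauss_star_def gauss_def[of _ _ "-1"] algebra_simps split del: if_split)
qed

lemma double_sum_recurrence_m:
  assumes c: "c \<le> 1" and A: "1 \<le> A" "3 * B \<le> 2 * A"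
  shows "double_sum c j A B = double_sum c j (A - 1) B + q ^ nat (A + int j - 1) * double_sum c j (A - 2) (B - 1)"
proof -
  define K where "K = nat (A + 2)"
  have K: "A + 1 < int K" using A by (simp add: K_def)
  show ?thesis
    using K double_sum_box[of A "Suc K" K c j B] double_sum_box[of "A - 1" "Suc K" K c j B]
      double_sum_box[of "A - 2" K K c j "B - 1"]
    by (simp add: sum.lessThan_Suc_shift summand_Suc_m[OF c A] summand_0_m[OF A]
        sum.distrib sum_distrib_left del: sum.lessThan_Suc)
qed

text \<open>This is Pascal's rule for the second coefficient.\<close>

lemma summand_Suc_n:
  assumes c: "c \<le> 1" and "1 \<le> B"
  shows "summand c j A B m (Suc n) = summand c j A (B - 1) m (Suc n)
    + q ^ nat (3 * B + 2 * int j - int c - 3) * summand c j (A - 3) (B - 2) m n"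
proof -
  define k where "k = B - int m - int (Suc n)"
  define l where "l = int (Suc n)"
  define h where "h = gauss_star q (A - 3 - int m - 3 * int n) (int m)"
  define e where "e = m^2 + 3*m*n + 3*n^2 + j*(m + 2*n) - c*n"
  define e' where "e' = m^2 + 3*m*(Suc n) + 3*(Suc n)^2 + j*(m + 2*(Suc n)) - c*Suc n"
  have s1: "summand c j A B m (Suc n) = q^e' * h * gauss (q^3) k l"
    by (simp add: summand_def k_def l_def h_def e'_def algebra_simps)
  have s2: "summand c j A (B - 1) m (Suc n) = q^e' * h * gauss (q^3) (k - 1) l"
    by (simp add: summand_def k_def l_def h_def e'_def algebra_simps)
  have s3: "summand c j (A - 3) (B - 2) m n = q^e * h * gauss (q^3) (k - 1) (l - 1)"
    by (simp add: summand_def k_def l_def h_def e_def algebra_simps)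
  show ?thesis
  proof (cases "k < l")
    case True
    then show ?thesis by (simp add: s1 s2 s3 gauss_neg)
  next
    case False
    have "gauss (q^3) k l
      = gauss (q^3) (k - 1) l + (q^3) ^ nat (k - l) * gauss (q^3) (k - 1) (l - 1)"
      using False by (intro gauss_pascal degree_q3) (auto simp: l_def)
    moreover have "e' + 3 * nat (k - l) = nat (3 * B + 2 * int j - int c - 3) + e"
    proof -
      have "int (nat (k - l)) = B - int m - 2 * (int n + 1)" using False by (simp add: k_def l_def)
      moreover have "int (nat (3 * B + 2 * int j - int c - 3)) = 3 * B + 2 * int j - int c - 3"
        using False c by (simp add: k_def l_def)
      ultimately have "int (e' + 3 * nat (k - l)) = int (nat (3 * B + 2 * int j - int c - 3) + e)"
        unfolding of_nat_add of_nat_mult e'_def e_def int_exponent[OF c]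
        by (simp add: algebra_simps power2_eq_square)
      then show ?thesis by (simp only: of_nat_eq_iff)
    qed
    then have "q ^ e' * (q^3) ^ nat (k - l) = q ^ nat (3 * B + 2 * int j - int c - 3) * q ^ e"
      by (simp only: power_add[symmetric] power_mult[symmetric])
    ultimately show ?thesis unfolding s1 s2 s3
      by (simp add: algebra_simps)
  qed
qed

text \<open>For \<open>n = 0\<close> the second coefficient changes from 1 to 0 only at \<open>m = B\<close>; the first
  coefficient vanishes there.\<close>

lemma summand_0_n:
  assumes "1 \<le> B" "A < 2 * B"
  shows "summand c j A B m 0 = summand c j A (B - 1) m 0"
proof (cases "B = int m")
  case True
  with assms show ?thesis by (auto simp: summand_def gauss_star_def gauss_def)
next
  case False
  then show ?thesis
    using gauss_0_right[OF degree_q3, of "B - int m"] gauss_0_right[OF degree_q3, of "B - 1 - int m"]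
    by (cases "B < int m") (auto simp: summand_def gauss_neg)
qed

lemma double_sum_recurrence_n:
  assumes c: "c \<le> 1" and B: "1 \<le> B" "A < 2 * B"
  shows "double_sum c j A B = double_sum c j A (B - 1)
    + q ^ nat (3 * B + 2 * int j - int c - 3) * double_sum c j (A - 3) (B - 2)"
proof -
  define K where "K = nat (\<bar>A\<bar> + 2)"
  have K: "A + 1 < int K" by (simp add: K_def)
  show ?thesis
    using K double_sum_box[of A K "Suc K" c j B] double_sum_box[of A K "Suc K" c j "B - 1"]
      double_sum_box[of "A - 3" K K c j "B - 2"]
    by (simp add: sum.lessThan_Suc_shift summand_Suc_n[OF c B(1)] summand_0_n[OF B]
        sum.distrib sum_distrib_left del: sum.lessThan_Suc)
qed

lemma double_sum_initial:
  assumes "0 \<le> A" "A \<le> 1" "0 \<le> B"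
  shows "double_sum c j A B = 1"
proof -
  have "double_sum c j A B = (\<Sum>m<3. \<Sum>n<3. summand c j A B m n)"
    using assms by (intro double_sum_box) auto
  also have "\<dots> = (\<Sum>m<3::nat. \<Sum>n<3::nat. if m = 0 \<and> n = 0 then 1 else 0)"
  proof (intro sum.cong refl)
    fix m n :: nat
    have "gauss q A 0 = 1" "gauss (q^3) B 0 = 1"
      using assms gauss_0_right[OF degree_q3] gauss_0_right[of q] by auto
    then show "summand c j A B m n = (if m = 0 \<and> n = 0 then 1 else 0)"
      using assms by (auto simp: summand_def gauss_star_def gauss_neg)
  qed
  also have "\<dots> = 1" by (simp add: eval_nat_numeral)
  finally show ?thesis .
qed

lemma double_sum_minus_1:
  shows "double_sum c j (-1) 0 = 1"
proof -
  have "double_sum c j (-1) 0 = (\<Sum>m<1. \<Sum>n<1. summand c j (-1) 0 m n)"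
    by (intro double_sum_box) auto
  then show ?thesis
    by (auto simp: summand_def gauss_star_def gauss_def qpoch_def)
qed

lemma Nil_partitions: "[] \<in> partitions s r N"
  by (simp add: partitions_def)

section \<open>Recurrences for the generating functions of partitions\<close>

text \<open>Conditions (c) and (d) need to be checked only at the greatest part when that part is added.\<close>

lemma partitions_snoc:
  "\<pi> @ [x] \<in> partitions s r N \<longleftrightarrow> x \<le> N \<and> s \<le> x \<and> \<pi> \<in> partitions s r x
     \<and> (\<forall>\<rho> y. \<pi> = \<rho> @ [y] \<longrightarrow> x \<le> y + 1 \<longrightarrow> [int y + int x = r] (mod 3))
     \<and> (\<forall>\<rho> z y. \<pi> = \<rho> @ [z, y] \<longrightarrow> z + 3 \<le> x)"
proof -
  have 1: "(\<forall>i. i + 2 < length (\<pi> @ [x]) \<longrightarrow> (\<pi> @ [x]) ! i + 3 \<le> (\<pi> @ [x]) ! (i + 2))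
     \<longleftrightarrow> (\<forall>i. i + 2 < length \<pi> \<longrightarrow> \<pi> ! i + 3 \<le> \<pi> ! (i + 2))
      \<and> (\<forall>\<rho> z y. \<pi> = \<rho> @ [z, y] \<longrightarrow> z + 3 \<le> x)" (is "?L = (?R1 \<and> ?R2)")
  proof
    assume L: ?L
    have ?R1
    proof (intro allI impI)
      fix i assume "i + 2 < length \<pi>"
      with L[rule_format, of i] show "\<pi> ! i + 3 \<le> \<pi> ! (i + 2)"
        by (simp add: nth_append)
    qed
    moreover have ?R2
    proof (intro allI impI)
      fix \<rho> z y assume "\<pi> = \<rho> @ [z, y]"
      with L[rule_format, of "length \<rho>"]
      have "(\<pi> @ [x]) ! length \<rho> + 3 \<le> (\<pi> @ [x]) ! (length \<rho> + 2)" by simp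
      with \<open>\<pi> = \<rho> @ [z, y]\<close> show "z + 3 \<le> x" by (simp add: nth_append)
    qed
    ultimately show "?R1 \<and> ?R2" by blast
  next
    assume R: "?R1 \<and> ?R2"
    show ?L
    proof (intro allI impI)
      fix i assume i: "i + 2 < length (\<pi> @ [x])"
      show "(\<pi> @ [x]) ! i + 3 \<le> (\<pi> @ [x]) ! (i + 2)"
      proof (cases "i + 2 < length \<pi>")
        case True then show ?thesis using R by (simp add: nth_append)
      next
        case False
        with i have len: "length \<pi> = Suc (Suc i)" by simp
        then obtain \<rho> z y where "\<pi> = \<rho> @ [z, y]" 
          by (metis append_Nil2 append_butlast_last_id butlast_append last_appendR length_append_singleton list.size(3) nat.distinct(1) Suc_inject append_assoc append_Cons append_Nil)
        with R len show ?thesis by (auto simp: nth_append)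
      qed
    qed
  qed
  have 2: "(\<forall>i. i + 1 < length (\<pi> @ [x]) \<and> (\<pi> @ [x]) ! (i + 1) \<le> (\<pi> @ [x]) ! i + 1
              \<longrightarrow> [int ((\<pi> @ [x]) ! i) + int ((\<pi> @ [x]) ! (i + 1)) = r] (mod 3))
     \<longleftrightarrow> (\<forall>i. i + 1 < length \<pi> \<and> \<pi> ! (i + 1) \<le> \<pi> ! i + 1
              \<longrightarrow> [int (\<pi> ! i) + int (\<pi> ! (i + 1)) = r] (mod 3))
      \<and> (\<forall>\<rho> y. \<pi> = \<rho> @ [y] \<longrightarrow> x \<le> y + 1 \<longrightarrow> [int y + int x = r] (mod 3))" (is "?L = (?R1 \<and> ?R2)")
  proof
    assume L: ?L
    have ?R1
    proof (intro allI impI)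
      fix i assume "i + 1 < length \<pi> \<and> \<pi> ! (i + 1) \<le> \<pi> ! i + 1"
      with L[rule_format, of i] show "[int (\<pi> ! i) + int (\<pi> ! (i + 1)) = r] (mod 3)"
        by (simp add: nth_append)
    qed
    moreover have ?R2
    proof (intro allI impI)
      fix \<rho> y assume *: "\<pi> = \<rho> @ [y]" "x \<le> y + 1"
      with L[rule_format, of "length \<rho>"] show "[int y + int x = r] (mod 3)"
        by (simp add: nth_append)
    qed
    ultimately show "?R1 \<and> ?R2" by blast
  next
    assume R: "?R1 \<and> ?R2"
    show ?L
    proof (intro allI impI)
      fix i assume i: "i + 1 < length (\<pi> @ [x]) \<and> (\<pi> @ [x]) ! (i + 1) \<le> (\<pi> @ [x]) ! i + 1"
      show "[int ((\<pi> @ [x]) ! i) + int ((\<pi> @ [x]) ! (i + 1)) = r] (mod 3)"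
      proof (cases "i + 1 < length \<pi>")
        case True then show ?thesis using R i by (simp add: nth_append)
      next
        case False
        with i have len: "length \<pi> = Suc i" by simp
        then obtain \<rho> y where "\<pi> = \<rho> @ [y]"
          by (metis length_Suc_conv_rev)
        with R len i show ?thesis by (auto simp: nth_append)
      qed
    qed
  qed
  show ?thesis
    unfolding partitions_def mem_Collect_eq 1 2 by (auto simp: sorted_append)
qed

text \<open>The admissible remainders of a partition whose greatest part is \<open>x\<close>.\<close>

definition remainders :: "nat \<Rightarrow> int \<Rightarrow> nat \<Rightarrow> nat list set" where
  "remainders s r x = {\<pi>. \<pi> @ [x] \<in> partitions s r x}"

lemma remainders_iff:
  "\<pi> \<in> remainders s r x \<longleftrightarrow> s \<le> x \<and> \<pi> \<in> partitions s r x
     \<and> (\<forall>\<rho> y. \<pi> = \<rho> @ [y] \<longrightarrow> x \<le> y + 1 \<longrightarrow> [int y + int x = r] (mod 3))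
     \<and> (\<forall>\<rho> z y. \<pi> = \<rho> @ [z, y] \<longrightarrow> z + 3 \<le> x)"
  by (simp add: remainders_def partitions_snoc)

lemma snoc_partitions_iff: "\<pi> @ [x] \<in> partitions s r N \<longleftrightarrow> x \<le> N \<and> \<pi> \<in> remainders s r x"
  unfolding remainders_iff partitions_snoc by blast

text \<open>The generating function of a set of partitions by the sum of the parts.\<close>

definition gf :: "nat list set \<Rightarrow> int poly" where
  "gf X = (\<Sum>\<pi>\<in>X. q ^ sum_list \<pi>)"

lemma P_eq_gf: "P s r N = gf (partitions s r N)"
  by (simp add: P_def gf_def)

lemma gf_Un: "finite X \<Longrightarrow> finite Y \<Longrightarrow> X \<inter> Y = {} \<Longrightarrow> gf (X \<union> Y) = gf X + gf Y"
  by (simp add: gf_def sum.union_disjoint)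

lemma gf_snoc: "gf ((\<lambda>\<pi>. \<pi> @ [x]) ` X) = q ^ x * gf X"
  by (simp add: gf_def sum.reindex inj_on_def sum_distrib_left power_add mult.commute)

lemma finite_remainders: "finite (remainders s r x)"
  by (rule finite_subset[OF _ finite_partitions[of s r x]]) (auto simp: remainders_iff)

lemma P_less_s:
  assumes "N < s" shows "P s r N = 1"
proof -
  have "partitions s r N = {[]}"
  proof -
    have "\<pi> = []" if "\<pi> \<in> partitions s r N" for \<pi>
      using that assms by (cases \<pi> rule: rev_cases) (auto simp: partitions_snoc)
    then show ?thesis using Nil_partitions by blast
  qed
  then show ?thesis by (simp add: P_def)
qed

lemma P_step:
  assumes "s \<le> N" "1 \<le> N"
  shows "P s r N = P s r (N - 1) + q ^ N * gf (remainders s r N)"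
proof -
  have "partitions s r N = partitions s r (N - 1) \<union> (\<lambda>\<pi>. \<pi> @ [N]) ` remainders s r N" (is "?L = ?R")
  proof (rule set_eqI)
    fix \<pi> show "\<pi> \<in> ?L \<longleftrightarrow> \<pi> \<in> ?R"
    proof (cases \<pi> rule: rev_cases)
      case Nil then show ?thesis using Nil_partitions by auto
    next
      case (snoc \<rho> y)
      have "\<pi> \<in> (\<lambda>\<pi>. \<pi> @ [N]) ` remainders s r N \<longleftrightarrow> y = N \<and> \<rho> \<in> remainders s r N"
        using snoc by auto
      with snoc assms show ?thesis by (cases "y = N") (auto simp: snoc_partitions_iff)
    qed
  qed
  moreover have "partitions s r (N - 1) \<inter> (\<lambda>\<pi>. \<pi> @ [N]) ` remainders s r N = {}"
    using assms by (auto simp: snoc_partitions_iff)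
  ultimately show ?thesis
    by (simp add: P_eq_gf gf_Un gf_snoc finite_partitions finite_remainders)
qed

lemma cong_3_iff: "[a = b] (mod 3) \<longleftrightarrow> (a - b) mod 3 = (0::int)"
  by (simp add: cong_iff_dvd_diff dvd_eq_mod_eq_0)

text \<open>The set of remainders of partitions with greatest part \<open>N\<close> depends on \<open>2 N - r\<close> modulo 3. If the
  residue is 2, neither \<open>N, N\<close> nor \<open>N - 1, N\<close> may end a partition. A remainder
  with parts at most \<open>N - 2\<close> satisfies the condition at distance two automatically, since
  \<open>N - 2, N - 2\<close> is not an admissible pair. Here and below the truncated subtraction is harmless: where
  it takes effect, only the empty partition has all parts in the range, because \<open>s \<ge> 1\<close>.\<close>

lemma remainders_simple:
  assumes "1 \<le> s" "s \<le> N" "(2 * int N - r) mod 3 = 2"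
  shows "remainders s r N = partitions s r (N - 2)"
proof (rule set_eqI)
  fix \<pi>
  show "\<pi> \<in> remainders s r N \<longleftrightarrow> \<pi> \<in> partitions s r (N - 2)"
  proof (cases \<pi> rule: rev_cases)
    case Nil then show ?thesis using assms Nil_partitions by (auto simp: remainders_iff)
  next
    case pi: (snoc \<rho> y)
    have "y \<le> N - 2" if "y \<le> N" "N \<le> y + 1 \<longrightarrow> (int y + int N - r) mod 3 = 0"
    proof (rule ccontr)
      assume "\<not> ?thesis"
      with that have "y = N \<or> int y = int N - 1" by linarith
      with that assms(3) show False by (auto; presburger)
    qed
    moreover have "z + 3 \<le> N"
      if "\<rho> @ [y] = \<rho>' @ [z, y']" "y \<le> N - 2" "\<rho> \<in> remainders s r y" for \<rho>' z y'
    proof -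
      have "\<rho> = \<rho>' @ [z]" using that by simp
      with that have "z \<le> y" "y \<le> z + 1 \<longrightarrow> (int z + int y - r) mod 3 = 0" "s \<le> y"
        by (auto simp: remainders_iff partitions_snoc cong_3_iff)
      with that assms show ?thesis by presburger
    qed
    ultimately show ?thesis
      using pi assms by (auto simp: remainders_iff[of _ _ _ N] snoc_partitions_iff cong_3_iff) (auto simp: remainders_iff)
  qed
qed

lemma image_snoc_iff: "\<rho> @ [y] \<in> (\<lambda>\<pi>. \<pi> @ [x]) ` X \<longleftrightarrow> y = x \<and> \<rho> \<in> X"
  by auto

lemma partitions_le_iff:
  assumes "M \<le> N"
  shows "\<rho> \<in> partitions s r M \<longleftrightarrow>
    \<rho> \<in> partitions s r N \<and> (\<forall>\<rho>' z. \<rho> = \<rho>' @ [z] \<longrightarrow> z \<le> M)"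
  using assms by (cases \<rho> rule: rev_cases) (auto simp: Nil_partitions snoc_partitions_iff)

text \<open>A greatest part that exceeds all others by at least 3 is subject to no further condition.\<close>

lemma remainders_gap_3:
  assumes "1 \<le> s" "s \<le> N" "\<rho> \<in> partitions s r (N - 3)"
  shows "\<rho> \<in> remainders s r N"
proof (cases \<rho> rule: rev_cases)
  case Nil then show ?thesis using assms Nil_partitions by (auto simp: remainders_iff)
next
  case (snoc \<rho>' y)
  then have y: "y \<le> N - 3" "\<rho>' \<in> remainders s r y" using assms by (auto simp: snoc_partitions_iff)
  then have "s \<le> y" by (simp add: remainders_iff)
  with y assms(1) have "y + 3 \<le> N" by linarith
  moreover have "z \<le> y" if "\<rho>' = \<rho>'' @ [z]" for \<rho>'' z
    using y(2) that by (simp add: remainders_iff partitions_snoc)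
  ultimately show ?thesis
    using snoc y assms by (fastforce simp: remainders_iff[of _ _ _ N] snoc_partitions_iff)
qed

text \<open>If \<open>2 N\<close> is congruent to \<open>r\<close>, the pair \<open>N, N\<close> is admissible, and \<open>N - 1, N\<close> is not.\<close>

lemma remainders_double:
  assumes "1 \<le> s" "s \<le> N" "(2 * int N - r) mod 3 = 0"
  shows "remainders s r N = partitions s r (N - 2) \<union> (\<lambda>\<pi>. \<pi> @ [N]) ` partitions s r (N - 3)"
proof (rule set_eqI)
  fix \<pi>
  show "\<pi> \<in> remainders s r N \<longleftrightarrow>
    \<pi> \<in> partitions s r (N - 2) \<union> (\<lambda>\<pi>. \<pi> @ [N]) ` partitions s r (N - 3)" (is "_ \<longleftrightarrow> _ \<in> ?R")
  proof (cases \<pi> rule: rev_cases)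
    case Nil then show ?thesis using assms Nil_partitions by (auto simp: remainders_iff)
  next
    case pi: (snoc \<rho> y)
    show ?thesis
    proof
      assume L: "\<pi> \<in> remainders s r N"
      then have y: "y \<le> N" "N \<le> y + 1 \<longrightarrow> (int y + int N - r) mod 3 = 0" "\<rho> \<in> remainders s r y"
        and z: "\<And>\<rho>' z. \<rho> = \<rho>' @ [z] \<Longrightarrow> z \<le> N - 3"
        using pi by (auto simp: remainders_iff[of _ _ _ N] snoc_partitions_iff cong_3_iff)
      have "int y \<noteq> int N - 1"
        using y(2) assms(3) by (intro notI) (simp; presburger)
      then have "y \<le> N - 2 \<or> y = N" using y(1) by linarith
      then show "\<pi> \<in> ?R"
      proof
        assume "y = N"
        moreover have "\<rho> \<in> partitions s r (N - 3)"
          using y z \<open>y = N\<close> partitions_le_iff[of "N - 3" N] by (auto simp: remainders_iff)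
        ultimately show ?thesis using pi by (simp add: image_snoc_iff)
      qed (use pi y in \<open>simp add: snoc_partitions_iff\<close>)
    next
      assume "\<pi> \<in> ?R"
      then consider "y \<le> N - 2" "\<rho> \<in> remainders s r y" | "y = N" "\<rho> \<in> partitions s r (N - 3)"
        using pi by (auto simp: snoc_partitions_iff image_snoc_iff)
      then show "\<pi> \<in> remainders s r N"
      proof cases
        case 1
        have "s \<le> y" using 1 by (auto simp: remainders_iff)
        then have "y + 2 \<le> N" using 1(1) assms(1) by linarith
        moreover have "z + 3 \<le> N" if "\<rho> = \<rho>' @ [z]" for \<rho>' z
        proof -
          have "z \<le> y" "y \<le> z + 1 \<longrightarrow> (int z + int y - r) mod 3 = 0"
            using 1 that by (auto simp: remainders_iff partitions_snoc cong_3_iff)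
          with \<open>y + 2 \<le> N\<close> assms show ?thesis by presburger
        qed
        ultimately show ?thesis
          using pi 1 assms by (auto simp: remainders_iff[of _ _ _ N] snoc_partitions_iff)
      next
        case 2
        have "z + 3 \<le> N" if "\<rho> = \<rho>' @ [z]" for \<rho>' z
        proof -
          have "z \<le> N - 3" "s \<le> z" using 2 that by (auto simp: partitions_snoc)
          with assms(1) show ?thesis by linarith
        qed
        then show ?thesis using pi 2 assms remainders_gap_3[OF assms(1,2) 2(2)]
          by (auto simp: remainders_iff[of "\<rho> @ _" _ _ N] snoc_partitions_iff cong_3_iff)
      qed
    qed
  qed
qed

text \<open>The partitions with parts at most \<open>N\<close> in which \<open>N\<close> occurs at most once: condition (c) excludes
  a third occurrence, and in a non-decreasing list two occurrences of \<open>N\<close> are the last two parts.\<close>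

definition simple_top :: "nat \<Rightarrow> int \<Rightarrow> nat \<Rightarrow> nat list set" where
  "simple_top s r N = {\<pi> \<in> partitions s r N. \<nexists>\<rho>. \<pi> = \<rho> @ [N, N]}"

text \<open>If \<open>2 N - 1\<close> is congruent to \<open>r\<close>, the pair \<open>N - 1, N\<close> is admissible, and \<open>N, N\<close> is not. As
  \<open>N - 2, N - 2\<close> is an admissible pair now, it has to be excluded below \<open>N\<close>.\<close>

lemma remainders_adjacent:
  assumes "1 \<le> s" "s \<le> N" "(2 * int N - r) mod 3 = 1"
  shows "remainders s r N = simple_top s r (N - 2)
    \<union> (if s \<le> N - 1 then (\<lambda>\<pi>. \<pi> @ [N - 1]) ` partitions s r (N - 3) else {})"
proof (rule set_eqI)
  fix \<pi>
  show "\<pi> \<in> remainders s r N \<longleftrightarrow> \<pi> \<in> simple_top s r (N - 2)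
    \<union> (if s \<le> N - 1 then (\<lambda>\<pi>. \<pi> @ [N - 1]) ` partitions s r (N - 3) else {})"
    (is "_ \<longleftrightarrow> _ \<in> ?R")
  proof (cases \<pi> rule: rev_cases)
    case Nil then show ?thesis using assms Nil_partitions by (auto simp: remainders_iff simple_top_def)
  next
    case pi: (snoc \<rho> y)
    show ?thesis
    proof
      assume L: "\<pi> \<in> remainders s r N"
      then have y: "y \<le> N" "N \<le> y + 1 \<longrightarrow> (int y + int N - r) mod 3 = 0" "\<rho> \<in> remainders s r y"
        and z: "\<And>\<rho>' z. \<rho> = \<rho>' @ [z] \<Longrightarrow> z + 3 \<le> N"
        using pi by (auto simp: remainders_iff[of _ _ _ N] snoc_partitions_iff cong_3_iff)
      have sy: "s \<le> y" using y by (simp add: remainders_iff)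
      have "y \<noteq> N"
        using y(2) assms(3) by (intro notI) simp
      then have "y \<le> N - 2 \<or> y = N - 1" using y(1) by linarith
      then show "\<pi> \<in> ?R"
      proof
        assume "y = N - 1"
        moreover have "\<rho> \<in> partitions s r (N - 3)"
          using y z \<open>y = N - 1\<close> partitions_le_iff[of "N - 3" "N - 1"] by (fastforce simp: remainders_iff)
        ultimately show ?thesis using pi sy by (simp add: image_snoc_iff)
      next
        assume "y \<le> N - 2"
        with sy assms(1) have "\<rho> \<noteq> \<rho>' @ [N - 2]" for \<rho>' using z[of \<rho>' "N - 2"] by auto
        moreover have "\<pi> \<in> partitions s r (N - 2)"
          using pi y \<open>y \<le> N - 2\<close> by (simp add: snoc_partitions_iff)
        ultimately show ?thesis using pi by (auto simp: simple_top_def)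
      qed
    next
      assume "\<pi> \<in> ?R"
      then consider "y \<le> N - 2" "\<rho> \<in> remainders s r y" "\<And>\<rho>'. \<not> (y = N - 2 \<and> \<rho> = \<rho>' @ [N - 2])"
        | "y = N - 1" "s \<le> N - 1" "\<rho> \<in> partitions s r (N - 3)"
        using pi by (auto simp: snoc_partitions_iff image_snoc_iff simple_top_def split: if_splits)
      then show "\<pi> \<in> remainders s r N"
      proof cases
        case 1
        have "s \<le> y" using 1 by (auto simp: remainders_iff)
        then have "y + 2 \<le> N" using 1(1) assms(1) by linarith
        moreover have "z + 3 \<le> N" if "\<rho> = \<rho>' @ [z]" for \<rho>' z
        proof -
          have "z \<le> y"
            using 1 that by (auto simp: remainders_iff partitions_snoc)
          moreover have "\<not> (y = N - 2 \<and> z = N - 2)" using 1(3)[of \<rho>'] that by auto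
          ultimately show ?thesis using \<open>y + 2 \<le> N\<close> by linarith
        qed
        ultimately show ?thesis
          using pi 1 assms by (auto simp: remainders_iff[of _ _ _ N] snoc_partitions_iff)
      next
        case 2
        have z: "z + 3 \<le> N" if "\<rho> = \<rho>' @ [z]" for \<rho>' z
        proof -
          have "z \<le> N - 3" "s \<le> z" using 2 that by (auto simp: partitions_snoc)
          with assms(1) show ?thesis by linarith
        qed
        have "x + 3 \<le> N - 1" if "\<rho> = \<rho>' @ [x, z]" for \<rho>' x z
        proof -
          have "(\<rho>' @ [x]) @ [z] \<in> partitions s r (N - 3)" using 2 that by simp
          then have "\<rho>' @ [x] \<in> partitions s r z" "z \<le> x + 1 \<longrightarrow> [int x + int z = r] (mod 3)"
            by (subst (asm) partitions_snoc, blast)+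
          then have xz: "x \<le> z" "z \<le> x + 1 \<longrightarrow> (int x + int z - r) mod 3 = 0"
            by (simp_all add: partitions_snoc cong_3_iff)
          have zN: "z + 3 \<le> N" using z[of "\<rho>' @ [x]"] that by simp
          show ?thesis
          proof (rule ccontr)
            assume "\<not> ?thesis"
            \<comment> \<open>Then \<open>x = z = N - 3\<close>, and \<open>2 (N - 3)\<close> is not congruent to \<open>r\<close>.\<close>
            with xz zN have "z \<le> x + 1" "int x + int z - r = (2 * int N - r) + 3 * (- 2)"
              by linarith+
            then show False using xz(2) assms(3) by (simp only: mod_mult_self2) simp
          qed
        qed
        moreover have "\<rho> \<in> partitions s r (N - 1)"
          using 2 partitions_le_iff[of "N - 3" "N - 1"] by auto
        ultimately have "\<rho> \<in> remainders s r (N - 1)"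
          using 2 z unfolding remainders_iff by fastforce
        moreover have "[int (N - 1) + int N = r] (mod 3)"
          using 2 assms by (simp add: cong_3_iff of_nat_diff) presburger
        ultimately show ?thesis using pi 2 assms z
          by (auto simp: remainders_iff[of "\<rho> @ _" _ _ N] snoc_partitions_iff)
      qed
    qed
  qed
qed

lemma P_recurrence_simple:
  assumes "1 \<le> s" "s \<le> N" "(2 * int N - r) mod 3 = 2"
  shows "P s r N = P s r (N - 1) + q ^ N * P s r (N - 2)"
  using assms P_step[of s N r] remainders_simple[of s N r] by (simp add: P_eq_gf)

lemma P_recurrence_double:
  assumes "1 \<le> s" "s \<le> N" "(2 * int N - r) mod 3 = 0"
  shows "P s r N = P s r (N - 1) + q ^ N * P s r (N - 2) + q ^ (2 * N) * P s r (N - 3)"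
proof -
  have "partitions s r (N - 2) \<inter> (\<lambda>\<pi>. \<pi> @ [N]) ` partitions s r (N - 3) = {}"
    using assms by (auto simp: snoc_partitions_iff)
  then have "gf (remainders s r N) = P s r (N - 2) + q ^ N * P s r (N - 3)"
    using assms remainders_double[of s N r] by (simp add: P_eq_gf gf_Un gf_snoc finite_partitions)
  moreover have "q ^ (2 * N) = q ^ N * q ^ N"
    by (simp only: mult_2 power_add)
  ultimately show ?thesis
    using assms P_step[of s N r] by (simp only: distrib_left mult.assoc add.assoc)
qed

text \<open>The partitions that end with \<open>N, N\<close> account for the third summand in \<open>P_recurrence_double\<close>;
  without them the first two remain.\<close>

lemma gf_simple_top:
  assumes "1 \<le> s" "s \<le> N" "(2 * int N - r) mod 3 = 0"
  shows "gf (simple_top s r N) = P s r (N - 1) + q ^ N * P s r (N - 2)"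
proof -
  have "simple_top s r N = partitions s r (N - 1) \<union> (\<lambda>\<pi>. \<pi> @ [N]) ` partitions s r (N - 2)"
    (is "_ = ?R")
  proof (rule set_eqI)
    fix \<pi> show "\<pi> \<in> simple_top s r N \<longleftrightarrow> \<pi> \<in> ?R"
    proof (cases \<pi> rule: rev_cases)
      case Nil then show ?thesis using Nil_partitions by (auto simp: simple_top_def)
    next
      case (snoc \<rho> y)
      have "\<rho> @ [N] \<notin> partitions s r (N - 2)" for \<rho>
        using assms by (auto simp: snoc_partitions_iff)
      then have "\<pi> \<in> simple_top s r N \<longleftrightarrow> y \<le> N \<and> \<rho> \<in> remainders s r y \<and> (y = N \<longrightarrow> \<rho> \<in> partitions s r (N - 2))"
        using snoc remainders_double[OF assms] by (auto simp: simple_top_def snoc_partitions_iff)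
      then show ?thesis
        using snoc assms remainders_double[OF assms] by (auto simp: snoc_partitions_iff image_snoc_iff)
    qed
  qed
  moreover have "partitions s r (N - 1) \<inter> (\<lambda>\<pi>. \<pi> @ [N]) ` partitions s r (N - 2) = {}"
    using assms by (auto simp: snoc_partitions_iff)
  ultimately show ?thesis
    by (simp add: P_eq_gf gf_Un gf_snoc finite_partitions)
qed

lemma gf_simple_top_less_s:
  assumes "N < s" shows "gf (simple_top s r N) = 1"
proof -
  have "simple_top s r N = {[]}"
  proof -
    have "\<pi> = []" if "\<pi> \<in> partitions s r N" for \<pi>
      using that assms by (cases \<pi> rule: rev_cases) (auto simp: partitions_snoc)
    then show ?thesis using Nil_partitions by (auto simp: simple_top_def)
  qed
  then show ?thesis by (simp add: gf_def)
qed

lemma P_recurrence_adjacent: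
  assumes "1 \<le> s" "s < N" "(2 * int N - r) mod 3 = 1"
  shows "P s r N = P s r (N - 1) + q ^ N * gf (simple_top s r (N - 2))
    + q ^ (2 * N - 1) * P s r (N - 3)"
proof -
  have "simple_top s r (N - 2) \<inter> (\<lambda>\<pi>. \<pi> @ [N - 1]) ` partitions s r (N - 3) = {}"
    using assms by (auto simp: snoc_partitions_iff simple_top_def)
  moreover have "finite (simple_top s r (N - 2))"
    by (simp add: simple_top_def finite_partitions)
  moreover have "s \<le> N - 1" using assms by simp
  ultimately have "gf (remainders s r N) = gf (simple_top s r (N - 2)) + q ^ (N - 1) * P s r (N - 3)"
    using assms remainders_adjacent[of s N r] by (simp add: P_eq_gf gf_Un gf_snoc finite_partitions)
  moreover have "q ^ (2 * N - 1) = q ^ N * q ^ (N - 1)"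
  proof -
    have "2 * N - 1 = N + (N - 1)" using assms by simp
    then show ?thesis by (simp only: power_add)
  qed
  ultimately show ?thesis
    using assms P_step[of s N r] by (simp only: distrib_left mult.assoc add.assoc)
qed

section \<open>The double sums count the partitions\<close>

text \<open>The number \<open>M = N - j\<close> is the number of admissible part sizes \<open>j + 1, \<dots>, N\<close>. The hypothesis
  on \<open>r\<close> says that \<open>2 N\<close> is congruent to \<open>r\<close> exactly if \<open>M\<close> is congruent to \<open>c\<close> modulo 3. Negative
  \<open>M\<close>, for which only the empty partition remains, are included because the recurrences reach back
  to them; \<open>M = -2\<close> is correct only for \<open>c = 1\<close>.\<close>

lemma P_eq_double_sum:
  fixes M :: int and r :: int
  assumes c: "c \<le> 1" and r: "(2 * int j + 2 * int c - r) mod 3 = 0" and "- 1 - int c \<le> M"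
  shows "P (j + 1) r (nat (M + int j)) = double_sum c j (M + 1) ((2 * M + int c) div 3 + 1)"
  using assms(3)
proof (induction "nat (M + 2)" arbitrary: M rule: less_induct)
  case less
  define F where "F M = P (j + 1) r (nat (M + int j))" for M
  have div0: "(2 * (3 * k + int c) + int c) div 3 + 1 = 2 * k + int c + 1"
    and div1: "(2 * (3 * k + int c + 1) + int c) div 3 + 1 = 2 * k + int c + 1"
    and div2: "(2 * (3 * k + int c + 2) + int c) div 3 + 1 = 2 * k + int c + 2" for k
    by presburger+
  have IH: "F M' = double_sum c j (M' + 1) ((2 * M' + int c) div 3 + 1)" if "- 1 - int c \<le> M'" "M' < M" for M'
    unfolding F_def using that c by (intro less.hyps) auto
  have IH0: "F (3 * k + int c) = double_sum c j (3 * k + int c + 1) (2 * k + int c + 1)"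
    if "- 1 - int c \<le> 3 * k + int c" "3 * k + int c < M" for k
    using IH[OF that] unfolding div0 .
  have IH1: "F (3 * k + int c + 1) = double_sum c j (3 * k + int c + 2) (2 * k + int c + 1)"
    if "- 1 - int c \<le> 3 * k + int c + 1" "3 * k + int c + 1 < M" for k
    using IH[OF that] unfolding div1 by (simp add: add.assoc)
  have IH2: "F (3 * k + int c + 2) = double_sum c j (3 * k + int c + 3) (2 * k + int c + 2)"
    if "- 1 - int c \<le> 3 * k + int c + 2" "3 * k + int c + 2 < M" for k
    using IH[OF that] unfolding div2 by (simp add: add.assoc)
  have c': "int c = 0 \<or> int c = 1" using c by linarith
  have F1: "F M' = 1" if "M' \<le> 0" for M'
    unfolding F_def using that by (intro P_less_s) auto
  show ?case
  proof (cases "M \<le> 0")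
    case True
    with less.prems c' consider "M = 0" | "M = -1" | "M = -2" "int c = 1" by linarith
    then have "double_sum c j (M + 1) ((2 * M + int c) div 3 + 1) = 1"
    proof cases
      case 3 then show ?thesis using double_sum_minus_1 by simp
    qed (use c' in \<open>auto intro!: double_sum_initial\<close>)
    then show ?thesis using F1[OF True] by (simp add: F_def)
  next
    case False
    define N where "N = nat (M + int j)"
    have N: "int N = M + int j" "j + 1 \<le> N" using False by (auto simp: N_def)
    have FN: "F M = P (j + 1) r N" "F (M - 1) = P (j + 1) r (N - 1)" "F (M - 2) = P (j + 1) r (N - 2)"
      "F (M - 3) = P (j + 1) r (N - 3)" "F (M - 4) = P (j + 1) r (N - 4)"
    proof -
      have "nat (M + int j) = N" "nat (M - 1 + int j) = N - 1" "nat (M - 2 + int j) = N - 2"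
        "nat (M - 3 + int j) = N - 3" "nat (M - 4 + int j) = N - 4"
        using N by linarith+
      then show "F M = P (j + 1) r N" "F (M - 1) = P (j + 1) r (N - 1)"
        "F (M - 2) = P (j + 1) r (N - 2)" "F (M - 3) = P (j + 1) r (N - 3)"
        "F (M - 4) = P (j + 1) r (N - 4)"
        by (simp_all only: F_def)
    qed
    obtain t where t: "r = 2 * int j + 2 * int c - 3 * t"
      using r by (metis mod_0_imp_dvd dvdE add_diff_cancel_left' diff_add_cancel add.commute)
    define k i where "k = (M - int c) div 3" and "i = (M - int c) mod 3"
    have "M = 3 * k + int c + i" by (simp add: k_def i_def)
    moreover have i: "i = 0 \<or> i = 1 \<or> i = 2"
      using pos_mod_bound[of 3 "M - int c"] pos_mod_sign[of 3 "M - int c"]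
      unfolding i_def by linarith
    ultimately have k: "0 \<le> k" using False c by linarith
    have "2 * int N - r = 2 * i + 3 * (2 * k + t)"
      unfolding t N \<open>M = _\<close> by simp
    then have Nr: "(2 * int N - r) mod 3 = (2 * i) mod 3"
      by (simp only: mod_mult_self2)
    have Nnat: "nat (M + 1 + int j - 1) = N" by (simp add: N_def)
    from i show ?thesis
    proof (elim disjE)
      assume "i = 0"
      then have M: "M = 3 * k + int c" using \<open>M = _\<close> by simp
      have "F M = F (M - 1) + q ^ N * F (M - 2) + q ^ (2 * N) * F (M - 3)"
        unfolding FN using N Nr \<open>i = 0\<close> by (intro P_recurrence_double) auto
      also have "F (M - 1) = double_sum c j (M + 1 - 1) (2 * k + int c)"
        using IH2[of "k - 1"] M c k False by (simp add: algebra_simps)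
      also have "F (M - 2) = double_sum c j (M + 1 - 2) (2 * k + int c - 1)"
        using IH1[of "k - 1"] M c k False by (simp add: algebra_simps)
      also have "F (M - 3) = double_sum c j (M + 1 - 3) (2 * k + int c + 1 - 2)"
      proof -
        have "2 \<le> 3 * k + 2 * int c" using c' M k False by (cases "k = 0") auto
        then show ?thesis using IH0[of "k - 1"] M by (simp add: algebra_simps)
      qed
      also have "double_sum c j (M + 1 - 1) (2 * k + int c) + q ^ N * double_sum c j (M + 1 - 2) (2 * k + int c - 1)
        = double_sum c j (M + 1) (2 * k + int c)"
        using double_sum_recurrence_m[of c "M + 1" "2 * k + int c" j] c M False Nnat by simp
      also have "\<dots> = double_sum c j (M + 1) (2 * k + int c + 1 - 1)" by simp
      also have "2 * N = nat (3 * (2 * k + int c + 1) + 2 * int j - int c - 3)"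
      proof -
        have "3 * (2 * k + int c + 1) + 2 * int j - int c - 3 = int (2 * N)"
          using M N by (simp add: of_nat_diff)
        then show ?thesis by (simp only: nat_int)
      qed
      also have "double_sum c j (M + 1) (2 * k + int c + 1 - 1) + q ^ \<dots> * double_sum c j (M + 1 - 3) (2 * k + int c + 1 - 2)
        = double_sum c j (M + 1) (2 * k + int c + 1)"
        using double_sum_recurrence_n[of c "2 * k + int c + 1" "M + 1" j] c M k by simp
      finally show ?thesis unfolding M F_def div0 .
    next
      assume "i = 1"
      then have M: "M = 3 * k + int c + 1" using \<open>M = _\<close> by simp
      have "F M = F (M - 1) + q ^ N * F (M - 2)"
        unfolding FN using N Nr \<open>i = 1\<close> by (intro P_recurrence_simple) auto
      also have "F (M - 1) = double_sum c j (M + 1 - 1) (2 * k + int c + 1)"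
        using IH0[of k] M c k by (simp add: algebra_simps)
      also have "F (M - 2) = double_sum c j (M + 1 - 2) (2 * k + int c + 1 - 1)"
        using IH2[of "k - 1"] M c k by (simp add: algebra_simps)
      also have "double_sum c j (M + 1 - 1) (2 * k + int c + 1) + q ^ N * double_sum c j (M + 1 - 2) (2 * k + int c + 1 - 1)
        = double_sum c j (M + 1) (2 * k + int c + 1)"
        using double_sum_recurrence_m[of c "M + 1" "2 * k + int c + 1" j] c M False Nnat by simp
      finally show ?thesis unfolding M F_def div1 .
    next
      assume "i = 2"
      then have M: "M = 3 * k + int c + 2" using \<open>M = _\<close> by simp
      have "F M = F (M - 1) + q ^ N * gf (simple_top (j + 1) r (N - 2)) + q ^ (2 * N - 1) * F (M - 3)"
        unfolding FN using N Nr \<open>i = 2\<close> M k by (intro P_recurrence_adjacent) auto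
      also have "gf (simple_top (j + 1) r (N - 2)) = double_sum c j (M + 1 - 2) (2 * k + int c)"
      proof (cases "M = 2")
        case True
        \<comment> \<open>Here \<open>N - 2 = j\<close> is smaller than the least admissible part size \<open>j + 1\<close>.\<close>
        then have "int c = 0" "k = 0" using M k by auto
        then have "double_sum c j (M + 1 - 2) (2 * k + int c) = 1"
          using True by (intro double_sum_initial) auto
        moreover have "N - 2 < j + 1" using N True by linarith
        ultimately show ?thesis by (simp add: gf_simple_top_less_s)
      next
        case False
        then have M3: "3 \<le> M" using k M by linarith
        have N2: "int (N - 2) = int N - 2" "j + 1 \<le> N - 2" using M3 N by linarith+
        have "2 * int (N - 2) - r = 3 * (2 * k + t)"
          unfolding N2 t N M by simp
        then have "gf (simple_top (j + 1) r (N - 2)) = F (M - 3) + q ^ (N - 2) * F (M - 4)"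
          using gf_simple_top[of "j + 1" "N - 2" r] N2 by (simp add: FN)
        also have "F (M - 3) = double_sum c j (M + 1 - 2 - 1) (2 * k + int c)"
          using IH2[of "k - 1"] M c k by (simp add: algebra_simps)
        also have "F (M - 4) = double_sum c j (M + 1 - 2 - 2) (2 * k + int c - 1)"
          using IH1[of "k - 1"] M M3 c k by (simp add: algebra_simps)
        also have "double_sum c j (M + 1 - 2 - 1) (2 * k + int c)
            + q ^ (N - 2) * double_sum c j (M + 1 - 2 - 2) (2 * k + int c - 1)
          = double_sum c j (M + 1 - 2) (2 * k + int c)"
        proof -
          have "nat (M + 1 - 2 + int j - 1) = N - 2" using N by linarith
          then show ?thesis
            using double_sum_recurrence_m[of c "M + 1 - 2" "2 * k + int c" j] c M M3 by simp
        qed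
        finally show ?thesis .
      qed
      also have "F (M - 1) = double_sum c j (M + 1 - 1) (2 * k + int c + 1)"
        using IH1[of k] M c k by (simp add: algebra_simps)
      also have "F (M - 3) = double_sum c j (M + 1 - 3) (2 * k + int c + 2 - 2)"
        using IH2[of "k - 1"] M c k by (simp add: algebra_simps)
      also have "double_sum c j (M + 1 - 1) (2 * k + int c + 1) + q ^ N * double_sum c j (M + 1 - 2) (2 * k + int c)
        = double_sum c j (M + 1) (2 * k + int c + 2 - 1)"
        using double_sum_recurrence_m[of c "M + 1" "2 * k + int c + 1" j] c M False Nnat by (simp add: ac_simps)
      also have "2 * N - 1 = nat (3 * (2 * k + int c + 2) + 2 * int j - int c - 3)"
      proof -
        have "3 * (2 * k + int c + 2) + 2 * int j - int c - 3 = int (2 * N - 1)"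
          using M N by (simp add: of_nat_diff)
        then show ?thesis by (simp only: nat_int)
      qed
      also have "double_sum c j (M + 1) (2 * k + int c + 2 - 1) + q ^ \<dots> * double_sum c j (M + 1 - 3) (2 * k + int c + 2 - 2)
        = double_sum c j (M + 1) (2 * k + int c + 2)"
        using double_sum_recurrence_n[of c "2 * k + int c + 2" "M + 1" j] c M k by simp
      finally show ?thesis unfolding M F_def div2 .
    qed
  qed
qed

section \<open>The eight identities\<close>

lemma floor_two_thirds:
  "\<lfloor>2/3 * real N\<rfloor> = (2 * int N) div 3"
  "\<lfloor>2/3 * (real N + 1)\<rfloor> = (2 * int N + 2) div 3"
  "\<lfloor>2/3 * (real N + 2)\<rfloor> = (2 * int N + 4) div 3"
  "\<lfloor>2/3 * (real N - 1)\<rfloor> = (2 * int N - 2) div 3"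
proof -
  have *: "\<lfloor>x\<rfloor> = k div 3" if "3 * x = of_int k" for x :: real and k
  proof -
    have x: "x = of_int k / of_int 3" using that by simp
    show ?thesis unfolding x using floor_divide_of_int_eq[where ?'a = real, of k 3] by simp
  qed
  show "\<lfloor>2/3 * real N\<rfloor> = (2 * int N) div 3"
    "\<lfloor>2/3 * (real N + 1)\<rfloor> = (2 * int N + 2) div 3"
    "\<lfloor>2/3 * (real N + 2)\<rfloor> = (2 * int N + 4) div 3"
    "\<lfloor>2/3 * (real N - 1)\<rfloor> = (2 * int N - 2) div 3"
    by (rule *; simp)+
qed

lemma P_eq_Sum_any:
  assumes "c \<le> 1" "(2 * int j + 2 * int c - r) mod 3 = 0" "int j \<le> int N + 1 + int c" "s = j + 1"
    and "\<And>m n. f (m, n)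
      = summand c j (int N + 1 - int j) ((2 * (int N - int j) + int c) div 3 + 1) m n"
  shows "P s r N = Sum_any f"
proof -
  have "f = (\<lambda>(m, n). summand c j (int N + 1 - int j) ((2 * (int N - int j) + int c) div 3 + 1) m n)"
    using assms(5) by auto
  then show ?thesis
    using P_eq_double_sum[OF assms(1,2), of "int N - int j"] assms(3,4) by (simp add: double_sum_def algebra_simps)
qed

lemma starred_eq_summand:
  assumes "e = m^2 + 3*m*n + 3*n^2 + j*(m + 2*n) - c*n"
    and "k = A - 3 * int n - int m" and "k' = B - int m - int n"
  shows "q ^ e * gauss_star q k (int m) * gauss (q^3) k' (int n) = summand c j A B m n"
  by (simp add: summand_def assms)

text \<open>The ordinary and the starred first coefficient differ only if \<open>A = 3 n - 1\<close> and \<open>m = 0\<close>.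
  Then \<open>B < 2 n\<close>, so that the second coefficient vanishes.\<close>

lemma unstarred_eq_summand:
  assumes e: "e = m^2 + 3*m*n + 3*n^2 + j*(m + 2*n) - c*n"
    and k: "k = A - 3 * int n - int m" "k' = B - int m - int n" and B: "3 * B \<le> 2 * A + 1"
  shows "q ^ e * gauss q k (int m) * gauss (q^3) k' (int n) = summand c j A B m n"
proof (cases "k = -1 \<and> m = 0")
  case True
  with k B have "k' < int n" by linarith
  then have "gauss (q^3) k' (int n) = 0" by (rule gauss_neg)
  then show ?thesis by (simp add: summand_def k)
next
  case False
  then show ?thesis by (auto simp: summand_def assms gauss_star_def)
qed

theorem proposition4p1:
  fixes N :: nat
  shows
    "S_0_m1 N = Sum_any (\<lambda>(m::nat, n::nat).
        q ^ (m^2 + 3*m*n + 3*n^2 - n)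
        * gauss_star q (int N + 1 - 3 * int n - int m) (int m)
        * gauss (q^3) (\<lfloor>2/3 * (real N + 2)\<rfloor> - int m - int n) (int n))
     \<and> S_0_0 N = Sum_any (\<lambda>(m::nat, n::nat).
        q ^ (m^2 + 3*m*n + 3*n^2)
        * gauss q (int N + 1 - 3 * int n - int m) (int m)
        * gauss (q^3) (\<lfloor>2/3 * real N\<rfloor> + 1 - int m - int n) (int n))
     \<and> S_1_1 N = Sum_any (\<lambda>(m::nat, n::nat).
        q ^ (m^2 + 3*m*n + 3*n^2 + m + n)
        * gauss_star q (int N - 3 * int n - int m) (int m)
        * gauss (q^3) (\<lfloor>2/3 * (real N + 1)\<rfloor> - int m - int n) (int n))
     \<and> S_1_2 N = Sum_any (\<lambda>(m::nat, n::nat).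
        q ^ (m^2 + 3*m*n + 3*n^2 + m + 2*n)
        * gauss q (int N - 3 * int n - int m) (int m)
        * gauss (q^3) (\<lfloor>2/3 * (real N - 1)\<rfloor> + 1 - int m - int n) (int n))
     \<and> S_2_3 N = Sum_any (\<lambda>(m::nat, n::nat).
        q ^ (m^2 + 3*m*n + 3*n^2 + 2*m + 3*n)
        * gauss_star q (int N - 3 * int n - int m - 1) (int m)
        * gauss (q^3) (\<lfloor>2/3 * real N\<rfloor> - int m - int n) (int n))
     \<and> S_2_4 N = (if N = 0 then 1 else Sum_any (\<lambda>(m::nat, n::nat).
        q ^ (m^2 + 3*m*n + 3*n^2 + 2*m + 4*n)
        * gauss q (int N - 3 * int n - int m - 1) (int m)
        * gauss (q^3) (\<lfloor>2/3 * (real N - 1)\<rfloor> + of_bool (3 dvd (int N - 2)) - int m - int n) (int n)))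
     \<and> S_3_5 N = (if N = 0 then 1 else Sum_any (\<lambda>(m::nat, n::nat).
        q ^ (m^2 + 3*m*n + 3*n^2 + 3*m + 5*n)
        * gauss_star q (int N - 3 * int n - int m - 2) (int m)
        * gauss (q^3) (\<lfloor>2/3 * (real N - 1)\<rfloor> - int m - int n) (int n)))
     \<and> S_3_6 N = (if N \<le> 1 then 1 else Sum_any (\<lambda>(m::nat, n::nat).
        q ^ (m^2 + 3*m*n + 3*n^2 + 3*m + 6*n)
        * gauss q (int N - 3 * int n - int m - 2) (int m)
        * gauss (q^3) (\<lfloor>2/3 * real N\<rfloor> - 1 - int m - int n) (int n)))"
proof (intro conjI, goal_cases)
  case 1
  show ?case
    by (rule P_eq_Sum_any[of 1 0], (simp; fail)+, simp only: prod.case, rule starred_eq_summand)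
      (unfold floor_two_thirds, (simp | presburger)+)
next
  case 2
  show ?case
    by (rule P_eq_Sum_any[of 0 0], (simp; fail)+, simp only: prod.case, rule unstarred_eq_summand)
      (unfold floor_two_thirds, (simp | presburger)+)
next
  case 3
  show ?case
    by (rule P_eq_Sum_any[of 1 1], (simp; fail)+, simp only: prod.case, rule starred_eq_summand)
      (unfold floor_two_thirds, (simp | presburger)+)
next
  case 4
  show ?case
    by (rule P_eq_Sum_any[of 0 1], (simp; fail)+, simp only: prod.case, rule unstarred_eq_summand)
      (unfold floor_two_thirds, (simp | presburger)+)
next
  case 5
  show ?case
    by (rule P_eq_Sum_any[of 1 2], (simp; fail)+, simp only: prod.case, rule starred_eq_summand)
      (unfold floor_two_thirds, (simp | presburger)+)
next
  case 6
  show ?case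
  proof (cases "N = 0")
    case True
    then show ?thesis by (simp add: P_less_s)
  next
    case False
    then show ?thesis
      by (subst if_not_P, assumption, intro P_eq_Sum_any[of 0 2], (simp; fail)+,
          simp only: prod.case, intro unstarred_eq_summand)
        (unfold floor_two_thirds of_bool_def, (simp | presburger)+)
  qed
next
  case 7
  show ?case
  proof (cases "N = 0")
    case True
    then show ?thesis by (simp add: P_less_s)
  next
    case False
    then show ?thesis
      by (subst if_not_P, assumption, intro P_eq_Sum_any[of 1 3], (simp; fail)+,
          simp only: prod.case, intro starred_eq_summand)
        (unfold floor_two_thirds, (simp | presburger)+)
  qed
next
  case 8
  show ?case
  proof (cases "N \<le> 1")
    case True
    then show ?thesis by (simp add: P_less_s)
  next
    case False
    then show ?thesis
      by (subst if_not_P, assumption, intro P_eq_Sum_any[of 0 3], (simp; fail)+,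
          simp only: prod.case, intro unstarred_eq_summand)
        (unfold floor_two_thirds, (simp | presburger)+)
  qed
qed

end
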